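(* Fix an integer $k\geq 2$. Let $t=t(n)$ and $b=b(n)$ be such that there exists a successful $(t,b)$-strategy for the $k$-th power of a Hamilton cycle. Then $b\geq n^{2k-1-o(1)}/t^{k-1}$.
   Context: Budget-constrained random graph process: let $M=\binom{n}{2}$. The edges of $K_n$ on vertex set $[n]$ are put in a uniformly random order $e_1,e_2,\ldots,e_M$. Builder is presented $e_1,\ldots,e_t$ one by one and, as each edge is presented and without knowledge of future edges, must irrevocably decide (possibly using additional randomness) whether to purchase it; she may purchase at most $b$ edges in total. A $(t,b)$-strategy is a rule for these decisions; $B_t$ denotes the graph of purchased edges after time $t$. A strategy is successful for a property $\mathcal{P}$ if $B_t$ satisfies $\mathcal{P}$ with probability tending to $1$ as $n\to\infty$. The $k$-th power of a graph $G$ is obtained from $G$ by joining every pair of vertices at distance at most $k$ in $G$; the property considered is that $B_t$ contains (as a subgraph) the $k$-th power of a cycle through all $n$ vertices. *)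

theory Defs
  imports "HOL-Probability.Probability" "HOL-Combinatorics.Multiset_Permutations"
    "HOL-Library.Landau_Symbols"
begin

text \<open>
  A graph on a vertex set \<open>V\<close> is given by its set \<open>E\<close> of edges, each edge being a
  two-element subset of \<open>V\<close>.
\<close>

definition complete_edges :: "nat \<Rightarrow> nat set set" where
  "complete_edges n = {e. e \<subseteq> {1..n} \<and> card e = 2}"

definition edge_orders :: "nat \<Rightarrow> nat set list set" where
  "edge_orders n = permutations_of_set (complete_edges n)"

definition graph_dist :: "'v set set \<Rightarrow> 'v \<Rightarrow> 'v \<Rightarrow> enat" where
  "graph_dist E u v = (INF l\<in>{l. (u, v) \<in> {(x, y). {x, y} \<in> E} ^^ l}. enat l)"

definition graph_power :: "nat \<Rightarrow> 'v set \<Rightarrow> 'v set set \<Rightarrow> 'v set set" where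
  "graph_power k V E =
     {{u, v} |u v. u \<in> V \<and> v \<in> V \<and> u \<noteq> v \<and> graph_dist E u v \<le> enat k}"

definition hamilton_cycle :: "'v set \<Rightarrow> 'v set set \<Rightarrow> bool" where
  "hamilton_cycle V C \<longleftrightarrow>
     (\<exists>vs. distinct vs \<and> set vs = V \<and> length vs \<ge> 3 \<and>
           C = {{vs ! i, vs ! (Suc i mod length vs)} |i. i < length vs})"

definition contains_ham_power :: "nat \<Rightarrow> nat \<Rightarrow> nat set set \<Rightarrow> bool" where
  "contains_ham_power k n B \<longleftrightarrow>
     (\<exists>C. hamilton_cycle {1..n} C \<and> graph_power k {1..n} C \<subseteq> B)"

text \<open>
  A decision rule \<open>D\<close> receives the list of all edges presented so far, the last one being
  the edge currently on offer, and says whether to purchase the latter.  Builder's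
  earlier decisions are determined by the same rule on shorter prefixes, so they need not
  be part of the argument.  The following is the edge set of \<open>B\<^sub>t\<close>.
\<close>

definition purchased :: "(nat set list \<Rightarrow> bool) \<Rightarrow> nat set list \<Rightarrow> nat \<Rightarrow> nat set set" where
  "purchased D es t = {es ! i |i. i < t \<and> D (take (Suc i) es)}"

text \<open>
  Builder's additional randomness is a random seed \<open>\<omega>\<close> from an arbitrary probability
  space \<open>\<Omega>\<close>, drawn independently of the order of the edges (independence is expressed by
  the product measure below); \<open>\<sigma> \<omega>\<close> is then a decision rule in the sense above.
\<close>

definition tb_strategy ::
  "nat \<Rightarrow> nat \<Rightarrow> nat \<Rightarrow> 'r measure \<Rightarrow> ('r \<Rightarrow> nat set list \<Rightarrow> bool) \<Rightarrow> bool" where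
  "tb_strategy n t b \<Omega> \<sigma> \<longleftrightarrow>
     t \<le> n choose 2 \<and> prob_space \<Omega> \<and>
     (\<forall>h. {\<omega> \<in> space \<Omega>. \<sigma> \<omega> h} \<in> sets \<Omega>) \<and>
     (\<forall>\<omega>\<in>space \<Omega>. \<forall>es\<in>edge_orders n. card (purchased (\<sigma> \<omega>) es t) \<le> b)"

definition process_measure :: "nat \<Rightarrow> 'r measure \<Rightarrow> ('r \<times> nat set list) measure" where
  "process_measure n \<Omega> = \<Omega> \<Otimes>\<^sub>M uniform_count_measure (edge_orders n)"

definition successful_strategy ::
  "(nat \<Rightarrow> nat set set \<Rightarrow> bool) \<Rightarrow> (nat \<Rightarrow> nat) \<Rightarrow> (nat \<Rightarrow> nat) \<Rightarrow>
   (nat \<Rightarrow> 'r measure) \<Rightarrow> (nat \<Rightarrow> 'r \<Rightarrow> nat set list \<Rightarrow> bool) \<Rightarrow> bool" where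
  "successful_strategy P t b \<Omega> \<sigma> \<longleftrightarrow>
     (\<forall>\<^sub>F n in sequentially. tb_strategy n (t n) (b n) (\<Omega> n) (\<sigma> n)) \<and>
     (\<lambda>n. \<P>(x in process_measure n (\<Omega> n). P n (purchased (\<sigma> n (fst x)) (snd x) (t n))))
       \<longlonglongrightarrow> 1"

text \<open>
  The success event is always measurable, so the probability above is never the default
  value of \<^const>\<open>measure\<close> on a non-measurable set.
\<close>

lemma finite_edge_orders: "finite (edge_orders n)"
  by (simp add: edge_orders_def)

lemma success_event_measurable:
  assumes "tb_strategy n t b \<Omega> \<sigma>"
  shows "{x \<in> space (process_measure n \<Omega>). P (purchased (\<sigma> (fst x)) (snd x) t)}
           \<in> sets (process_measure n \<Omega>)"
proof -
  have meas [measurable]: "Measurable.pred \<Omega> (\<lambda>\<omega>. \<sigma> \<omega> h)" for h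
    using assms by (simp add: tb_strategy_def pred_def)
  have 1: "{\<omega> \<in> space \<Omega>. P (purchased (\<sigma> \<omega>) es t)} \<in> sets \<Omega>" for es
  proof -
    let ?B = "\<lambda>S. {es ! i |i. i \<in> S}"
    have "{\<omega> \<in> space \<Omega>. P (purchased (\<sigma> \<omega>) es t)} =
      (\<Union>S\<in>{S \<in> Pow {..<t}. P (?B S)}.
         {\<omega> \<in> space \<Omega>. \<forall>i\<in>{..<t}. \<sigma> \<omega> (take (Suc i) es) \<longleftrightarrow> i \<in> S})" (is "?L = ?R")
    proof (intro equalityI subsetI)
      fix \<omega> assume w: "\<omega> \<in> ?L"
      let ?S = "{i. i < t \<and> \<sigma> \<omega> (take (Suc i) es)}"
      have "P (?B ?S)" using w by (simp add: purchased_def)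
      moreover have "?S \<in> Pow {..<t}" by auto
      ultimately show "\<omega> \<in> ?R" using w by (intro UN_I[of ?S]) auto
    next
      fix \<omega> assume "\<omega> \<in> ?R"
      then obtain S where S: "S \<subseteq> {..<t}" "P (?B S)" "\<omega> \<in> space \<Omega>"
        "\<forall>i\<in>{..<t}. \<sigma> \<omega> (take (Suc i) es) \<longleftrightarrow> i \<in> S" by auto
      have "purchased (\<sigma> \<omega>) es t = ?B S" using S(1,4) by (auto simp: purchased_def)
      with S show "\<omega> \<in> ?L" by simp
    qed
    also have "\<dots> \<in> sets \<Omega>" by (intro sets.finite_UN) auto
    finally show ?thesis .
  qed
  have "{x \<in> space (process_measure n \<Omega>). P (purchased (\<sigma> (fst x)) (snd x) t)} =
    (\<Union>es\<in>edge_orders n. {\<omega> \<in> space \<Omega>. P (purchased (\<sigma> \<omega>) es t)} \<times> {es})"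
    by (auto simp: process_measure_def space_pair_measure space_uniform_count_measure)
  also have "\<dots> \<in> sets (process_measure n \<Omega>)"
    unfolding process_measure_def
    by (intro sets.finite_UN finite_edge_orders pair_measureI 1)
       (auto simp: sets_uniform_count_measure)
  finally show ?thesis .
qed

end

theory Submission
  imports Defs
begin

text \<open>
  Fix Builder's randomness.  Record those purchased edges of the target copy which, on arrival,
  join two components of the graph of edges recorded so far, together with the difference of the
  positions of their end points on the cycle.  There are at most \<open>n\<close> such edges, so the record can
  be chosen in at most \<open>(2 e k b / n) ^ n\<close> ways.  Given the record, each of the remaining
  \<open>(k - 1) n\<close> or more edges of the copy is known before it arrives, and it has to appear among the
  first \<open>t\<close> edges.  For a fixed record this happens with probability at most
  \<open>2 ^ (k n) * (t / M) ^ ((k - 1) n)\<close>, where \<open>M = n choose 2\<close>.  A union bound over the records shows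
  that success is unlikely unless \<open>b / n * (t / M) ^ (k - 1)\<close> is bounded below by a constant.
\<close>

section \<open>Catching adaptively declared targets in a random permutation\<close>

text \<open>\<open>W\<close> is a prediction rule: \<open>W h\<close> is the set of targets declared
  once the history \<open>h\<close> is known, and a hit is an entry that was a target just before it
  arrived.\<close>

definition hits :: "('a list \<Rightarrow> 'a set) \<Rightarrow> 'a list \<Rightarrow> nat" where
  "hits W h = (\<Sum>i<length h. of_bool (h ! i \<in> W (take i h)))"

lemma hits_Nil [simp]: "hits W [] = 0"
  by (simp add: hits_def)

lemma hits_Cons: "hits W (e # h) = of_bool (e \<in> W []) + hits (\<lambda>h. W (e # h)) h"
  unfolding hits_def by (simp only: length_Cons sum.lessThan_Suc_shift) simp

lemma hits_snoc: "hits W (h @ [e]) = hits W h + of_bool (e \<in> W h)"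
  by (auto simp: hits_def nth_append intro!: sum.cong)

lemma hits_cong:
  assumes "\<And>i. i < length h \<Longrightarrow> W (take i h) = W' (take i h)"
  shows "hits W h = hits W' h"
  unfolding hits_def using assms by (intro sum.cong) auto

text \<open>Bernoulli's inequality for \<open>1 + a / g\<close>, scaled by \<open>g ^ R\<close>. It
  turns the one-step average in \<open>adaptive_hits_step\<close> back into an \<open>R\<close>-th
  power.\<close>

lemma bernoulli_add:
  fixes a g :: real
  assumes "a \<ge> 0" "g > 0"
  shows "g ^ R + real R * g ^ (R - 1) * a \<le> (g + a) ^ R"
proof (cases R)
  case (Suc r)
  have "1 + real R * (a / g) \<le> (1 + a / g) ^ R"
    using assms by (intro Bernoulli_inequality) (smt (verit) divide_nonneg_pos)
  then have "g ^ R * (1 + real R * (a / g)) \<le> g ^ R * (1 + a / g) ^ R"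
    using assms by (intro mult_left_mono) auto
  also have "\<dots> = (g + a) ^ R"
    using assms by (simp add: power_mult_distrib[symmetric] field_simps)
  also have "g ^ R * (1 + real R * (a / g)) = g ^ R + real R * g ^ (R - 1) * a"
    using assms Suc by (simp add: field_simps)
  finally show ?thesis .
qed simp

text \<open>Of \<open>M\<close> equally likely first elements, \<open>q\<close> are targets. Drawing
  one gains a factor \<open>z\<close> and leaves \<open>R - 1\<close> possible hits; otherwise
  \<open>R\<close> remain. Since \<open>g \<le> z\<close>, the sum grows with \<open>q\<close>, so
  \<open>q\<close> may be raised to \<open>R\<close>; then \<open>bernoulli_add\<close>
  applies.\<close>

lemma adaptive_hits_step:
  fixes z :: real
  assumes "z \<ge> 1" "Suc t \<le> M" "q \<le> R"
  defines "g \<equiv> 1 + (z - 1) * (real t / real (M - 1))"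
  shows "real q * (z * g ^ (R - 1)) + (real M - real q) * g ^ R
           \<le> real M * (1 + (z - 1) * (real (Suc t) / real M)) ^ R"
proof -
  have M: "real (M - 1) = real M - 1" "real M > 0" using assms by auto
  \<comment> \<open>For \<open>M = 1\<close> we have \<open>t = 0\<close>, and the quotient
    \<open>0 / 0\<close> is \<open>0\<close> by convention.\<close>
  have x: "real t / real (M - 1) \<le> 1"
    using assms by (cases "M = 1") auto
  define x where "x = real t / real (M - 1)"
  have x01: "0 \<le> x" "x \<le> 1" using x by (auto simp: x_def)
  have g: "g \<ge> 1" "g \<le> z"
    using assms(1) x01 mult_left_mono[OF x01(2), of "z - 1"] by (auto simp: g_def x_def)
  have tx: "real t = x * (real M - 1)"
    using M assms(2) by (cases "M = 1") (auto simp: x_def)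
  \<comment> \<open>The increase of the factor per target when \<open>t\<close> draws out of
    \<open>M - 1\<close> become \<open>t + 1\<close> draws out of \<open>M\<close>.\<close>
  define a where "a = (z - g) / real M"
  have a: "a \<ge> 0" using g M by (simp add: a_def)
  have "real M * (1 + (z - 1) * (real (Suc t) / real M)) = real M * (g + a)"
    using M(2) unfolding g_def a_def x_def[symmetric]
    by (simp add: field_simps tx)
  then have eq: "1 + (z - 1) * (real (Suc t) / real M) = g + a"
    using M(2) by simp
  have "real q * (z * g ^ (R - 1)) + (real M - real q) * g ^ R
      = real M * g ^ R + real q * g ^ (R - 1) * (z - g)"
    using assms(3) by (cases R) (auto simp: algebra_simps)
  also have "\<dots> \<le> real M * g ^ R + real R * g ^ (R - 1) * (z - g)"
    using assms(3) g by (intro add_left_mono mult_right_mono) auto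
  also have "\<dots> = real M * (g ^ R + real R * g ^ (R - 1) * a)"
    using M by (simp add: a_def field_simps)
  also have "\<dots> \<le> real M * (g + a) ^ R"
    using bernoulli_add[OF a, of g R] g M by (intro mult_left_mono) auto
  finally show ?thesis unfolding eq .
qed

lemma sum_permutations_of_set_Cons:
  assumes "finite E" "E \<noteq> {}"
  shows "(\<Sum>es\<in>permutations_of_set E. F es)
       = (\<Sum>e\<in>E. \<Sum>es\<in>permutations_of_set (E - {e}). F (e # es))"
proof -
  have "(\<Sum>es\<in>permutations_of_set E. F es)
      = (\<Sum>e\<in>E. \<Sum>es\<in>(#) e ` permutations_of_set (E - {e}). F es)"
    unfolding permutations_of_set_nonempty[OF assms(2)]
    using assms(1) by (intro sum.UNION_disjoint) auto
  also have "\<dots> = (\<Sum>e\<in>E. \<Sum>es\<in>permutations_of_set (E - {e}). F (e # es))"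
    by (rule sum.cong[OF refl]) (simp add: sum.reindex)
  finally show ?thesis .
qed

text \<open>
  Until it is hit, each of the at most \<open>R\<close> targets is caught by the remaining part of the
  first \<open>t\<close> positions with probability at most \<open>t / card E\<close>, no matter when it was declared.
\<close>

lemma adaptive_hits:
  fixes z :: real
  assumes "finite E" "t \<le> card E" "z \<ge> 1"
    and "\<And>h. finite (W h)"
    and "\<And>h. W h \<noteq> {} \<Longrightarrow> hits W h + card (W h) \<le> R"
  shows "(\<Sum>es\<in>permutations_of_set E. z ^ hits W (take t es))
           \<le> fact (card E) * (1 + (z - 1) * (real t / real (card E))) ^ R"
  using assms
proof (induction t arbitrary: E W R)
  case 0
  then show ?case by simp
next
  case (Suc t)
  define M where "M = card E"
  define g where "g = 1 + (z - 1) * (real t / real (M - 1))"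
  define q where "q = card (E \<inter> W [])"
  have M: "Suc t \<le> M" using Suc.prems by (simp add: M_def)
  have ne: "E \<noteq> {}" using M by (auto simp: M_def)
  have g: "g \<ge> 1" using Suc.prems by (simp add: g_def)
  have qW: "q \<le> card (W [])" unfolding q_def using Suc.prems by (intro card_mono) auto
  have qR: "q \<le> R"
    using qW Suc.prems(5)[of "[]"] by (cases "W [] = {}") auto
  have qM: "q \<le> M" unfolding q_def M_def using Suc.prems by (intro card_mono) auto
  have inner: "(\<Sum>es\<in>permutations_of_set (E - {e}). z ^ hits W (take (Suc t) (e # es)))
        \<le> fact (M - 1) * (if e \<in> W [] then z * g ^ (R - 1) else g ^ R)" if e: "e \<in> E" for e
  proof -
    \<comment> \<open>Once \<open>e\<close> has been drawn, the rule reads histories that start with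
      \<open>e\<close>, and a hit on \<open>e\<close> uses up one of the \<open>R\<close> possible
      hits.\<close>
    let ?W = "\<lambda>h. W (e # h)" and ?R = "R - of_bool (e \<in> W [])"
    have c: "card (E - {e}) = M - 1" using e by (simp add: M_def)
    have bd: "hits ?W h + card (?W h) \<le> ?R" if "?W h \<noteq> {}" for h
      using Suc.prems(5)[of "e # h"] that by (auto simp: hits_Cons)
    have "(\<Sum>es\<in>permutations_of_set (E - {e}). z ^ hits W (take (Suc t) (e # es)))
        = z ^ of_bool (e \<in> W []) * (\<Sum>es\<in>permutations_of_set (E - {e}). z ^ hits ?W (take t es))"
      by (simp add: hits_Cons power_add sum_distrib_left)
    also have "\<dots> \<le> z ^ of_bool (e \<in> W []) * (fact (M - 1) * g ^ ?R)"
      using Suc.IH[of "E - {e}" ?W ?R] bd c M Suc.prems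
      by (intro mult_left_mono) (auto simp: g_def)
    finally show ?thesis by (cases "e \<in> W []") (simp_all add: algebra_simps)
  qed
  have "(\<Sum>es\<in>permutations_of_set E. z ^ hits W (take (Suc t) es))
      = (\<Sum>e\<in>E. \<Sum>es\<in>permutations_of_set (E - {e}). z ^ hits W (take (Suc t) (e # es)))"
    using sum_permutations_of_set_Cons Suc.prems(1) ne by blast
  also have "\<dots> \<le> (\<Sum>e\<in>E. fact (M - 1) * (if e \<in> W [] then z * g ^ (R - 1) else g ^ R))"
    by (intro sum_mono inner)
  also have "\<dots> = fact (M - 1) * (real q * (z * g ^ (R - 1)) + (real M - real q) * g ^ R)"
  proof -
    have "real (card (E - W [])) = real M - real q"
      using Suc.prems(1) qM unfolding q_def M_def
      by (subst card_Diff_subset_Int) (auto intro: of_nat_diff)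
    then show ?thesis
      using Suc.prems(1) by (simp add: sum_distrib_left[symmetric] sum.If_cases q_def Int_def
          Diff_eq Compl_eq)
  qed
  also have "\<dots> \<le> fact (M - 1) * (real M * (1 + (z - 1) * (real (Suc t) / real M)) ^ R)"
    unfolding g_def using adaptive_hits_step[OF Suc.prems(3) M qR] by (intro mult_left_mono) auto
  also have "\<dots> = fact M * (1 + (z - 1) * (real (Suc t) / real M)) ^ R"
    using M by (simp add: fact_reduce)
  finally show ?case by (simp only: M_def)
qed


section \<open>Counting small subsets\<close>

text \<open>Give each subset \<open>S\<close> of \<open>A\<close> the weight
  \<open>s ^ card S\<close>. The weights sum to \<open>(1 + s) ^ card A\<close>, and as
  \<open>s \<le> 1\<close> every set of size at most \<open>n\<close> weighs at least
  \<open>s ^ n\<close>.\<close>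

lemma card_bounded_subsets_le:
  fixes s :: real
  assumes "finite A" "0 < s" "s \<le> 1"
  shows "real (card {S. S \<subseteq> A \<and> card S \<le> n}) * s ^ n \<le> (1 + s) ^ card A"
proof -
  have "real (card {S. S \<subseteq> A \<and> card S \<le> n}) * s ^ n = (\<Sum>S\<in>{S. S \<subseteq> A \<and> card S \<le> n}. s ^ n)"
    by simp
  also have "\<dots> \<le> (\<Sum>S\<in>{S. S \<subseteq> A \<and> card S \<le> n}. s ^ card S)"
    using assms by (intro sum_mono power_decreasing) auto
  also have "\<dots> \<le> (\<Sum>S\<in>Pow A. s ^ card S)"
    using assms by (intro sum_mono2) auto
  also have "\<dots> = (\<Prod>a\<in>A. s + 1)"
    using assms by (subst prod_add) auto
  finally show ?thesis by (simp add: add.commute)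
qed

lemma card_bounded_subsets_exp_le:
  fixes x :: real
  assumes "finite A" "n > 0" "n \<le> x" "card A \<le> x"
  shows "real (card {S. S \<subseteq> A \<and> card S \<le> n}) \<le> (exp 1 * x / n) ^ n"
proof -
  \<comment> \<open>With this weight \<open>(1 + s) ^ card A\<close> is at most
    \<open>exp n\<close>, while dividing by \<open>s ^ n\<close> costs
    \<open>(x / n) ^ n\<close>.\<close>
  define s where "s = n / x"
  have s: "0 < s" "s \<le> 1" using assms by (auto simp: s_def)
  have "real (card {S. S \<subseteq> A \<and> card S \<le> n}) * s ^ n \<le> (1 + s) ^ card A"
    using card_bounded_subsets_le[OF assms(1) s] .
  also have "\<dots> \<le> exp s ^ card A"
    using s by (intro power_mono exp_ge_add_one_self) auto
  also have "\<dots> = exp (card A * s)" by (simp add: exp_of_nat_mult)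
  also have "\<dots> \<le> exp (x * s)"
    using assms(4) s by (simp add: mult_right_mono)
  also have "x * s = n" using assms by (simp add: s_def)
  also have "exp (real n) = exp 1 ^ n" using exp_of_nat_mult[of n "1::real"] by simp
  finally have "real (card {S. S \<subseteq> A \<and> card S \<le> n}) \<le> exp 1 ^ n / s ^ n"
    using s by (simp add: pos_le_divide_eq)
  also have "\<dots> = (exp 1 * x / n) ^ n"
    using assms by (simp add: s_def power_mult_distrib power_divide field_simps)
  finally show ?thesis .
qed

section \<open>Powers of Hamilton cycles in terms of cyclic positions\<close>

text \<open>A copy of the cycle is encoded by the position of each vertex on it. Integer positions
  allow differences to be taken modulo \<open>n\<close>; rotations of a placement describe the same
  copy.\<close>

definition placements :: "nat \<Rightarrow> (nat \<Rightarrow> int) set" where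
  "placements n = {\<pi>. bij_betw \<pi> {1..n} {0..<int n}}"

definition power_edges :: "nat \<Rightarrow> nat \<Rightarrow> (nat \<Rightarrow> int) \<Rightarrow> nat set set" where
  "power_edges n k \<pi> =
     {{u, v} |u v. u \<in> {1..n} \<and> v \<in> {1..n} \<and> (\<pi> v - \<pi> u) mod int n \<in> {1..int k}}"

lemma power_edgesI:
  assumes "u \<in> {1..n}" "v \<in> {1..n}" "(\<pi> v - \<pi> u) mod int n \<in> {1..int k}"
  shows "{u, v} \<in> power_edges n k \<pi>"
  using assms unfolding power_edges_def by blast

lemma power_edgesE:
  assumes "e \<in> power_edges n k \<pi>"
  obtains u v where "u \<in> {1..n}" "v \<in> {1..n}" "e = {u, v}"
    "(\<pi> v - \<pi> u) mod int n \<in> {1..int k}"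
  using assms unfolding power_edges_def by blast

text \<open>Each edge arises from exactly one pair of a start vertex and a forward step
  \<open>d\<close> in \<open>{1..k}\<close>. If both orientations occurred, with steps
  \<open>d\<close> and \<open>d'\<close>, then \<open>d + d'\<close> would be divisible by
  \<open>n\<close>, although \<open>0 < d + d' \<le> 2 * k < n\<close>.\<close>

lemma card_power_edges:
  assumes pi: "\<pi> \<in> placements n" and n: "n \<ge> 2 * k + 1"
  shows "card (power_edges n k \<pi>) = k * n"
proof -
  have bij: "bij_betw \<pi> {1..n} {0..<int n}" using pi by (simp add: placements_def)
  define \<rho> where "\<rho> = the_inv_into {1..n} \<pi>"
  have rho: "\<rho> x \<in> {1..n}" "\<pi> (\<rho> x) = x" if "x \<in> {0..<int n}" for x
    using bij that unfolding \<rho>_def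
    by (metis bij_betw_apply bij_betw_the_inv_into,
        metis bij_betw_def f_the_inv_into_f)
  have rho': "\<rho> (\<pi> u) = u" if "u \<in> {1..n}" for u
    using bij that unfolding \<rho>_def by (metis bij_betw_def the_inv_into_f_f)
  have range: "\<pi> u \<in> {0..<int n}" if "u \<in> {1..n}" for u
    using bij that by (rule bij_betw_apply)
  define nxt where "nxt = (\<lambda>(u, d). \<rho> ((\<pi> u + d) mod int n))"
  define F where "F = (\<lambda>(u, d). {u, nxt (u, d)})"
  have nxt: "nxt (u, d) \<in> {1..n}" "\<pi> (nxt (u, d)) = (\<pi> u + d) mod int n" for u d
    using rho[of "(\<pi> u + d) mod int n"] n by (auto simp: nxt_def)
  have diff: "(\<pi> (nxt (x, y)) - \<pi> x) mod int n = y" if "y \<in> {1..int k}" for x y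
  proof -
    have "(\<pi> (nxt (x, y)) - \<pi> x) mod int n = y mod int n"
      unfolding nxt(2) mod_diff_left_eq by simp
    also have "\<dots> = y" using that n by (intro mod_pos_pos_trivial) auto
    finally show ?thesis .
  qed
  have "F ` ({1..n} \<times> {1..int k}) = power_edges n k \<pi>"
  proof (intro equalityI subsetI)
    fix e assume "e \<in> F ` ({1..n} \<times> {1..int k})"
    then obtain x where x: "x \<in> {1..n} \<times> {1..int k}" "e = F x" by blast
    obtain u d where "x = (u, d)" by (cases x)
    with x have ud: "u \<in> {1..n}" "d \<in> {1..int k}" "e = {u, nxt (u, d)}"
      by (simp_all add: F_def)
    show "e \<in> power_edges n k \<pi>"
      unfolding ud(3) by (rule power_edgesI) (use ud diff nxt(1) in simp_all)
  next
    fix e assume "e \<in> power_edges n k \<pi>"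
    then obtain u v where uv: "u \<in> {1..n}" "v \<in> {1..n}" "e = {u, v}"
      "(\<pi> v - \<pi> u) mod int n \<in> {1..int k}"
      by (rule power_edgesE)
    define d where "d = (\<pi> v - \<pi> u) mod int n"
    have "(\<pi> u + d) mod int n = \<pi> v"
      using range[OF uv(2)] by (simp add: d_def mod_add_right_eq)
    then have "nxt (u, d) = v" using rho'[OF uv(2)] by (simp add: nxt_def)
    then have "e = F (u, d)" using uv by (simp add: F_def)
    then show "e \<in> F ` ({1..n} \<times> {1..int k})"
      by (rule image_eqI) (use uv(1,4) d_def in simp)
  qed
  moreover have "inj_on F ({1..n} \<times> {1..int k})"
  proof (rule inj_onI, clarify)
    fix u d u' d'
    assume u: "u \<in> {1..n}" "u' \<in> {1..n}" and d: "d \<in> {1..int k}" "d' \<in> {1..int k}"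
      and eq: "F (u, d) = F (u', d')"
    from eq consider "u = u'" "nxt (u, d) = nxt (u', d')" | "u = nxt (u', d')" "u' = nxt (u, d)"
      by (auto simp: F_def doubleton_eq_iff)
    then show "u = u' \<and> d = d'"
    proof cases
      case 1
      then show ?thesis using diff[OF d(1), of u] diff[OF d(2), of u'] by metis
    next
      case 2
      have "(\<pi> u' - \<pi> u) mod int n = d" "(\<pi> u - \<pi> u') mod int n = d'"
        using diff[OF d(1), of u] diff[OF d(2), of u'] 2 by metis+
      then have "(d + d') mod int n = ((\<pi> u' - \<pi> u) + (\<pi> u - \<pi> u')) mod int n"
        by (metis mod_add_eq)
      then have "(d + d') mod int n = 0" by simp
      moreover have "(d + d') mod int n = d + d'"
        using d n by (intro mod_pos_pos_trivial) auto
      ultimately show ?thesis using d by simp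
    qed
  qed
  ultimately have "card (power_edges n k \<pi>) = card ({1..n} \<times> {1..int k})"
    using card_image by metis
  then show ?thesis by (simp add: card_cartesian_product)
qed

lemma finite_power_edges: "finite (power_edges n k \<pi>)"
proof (rule finite_subset)
  show "power_edges n k \<pi> \<subseteq> Pow {1..n}" by (auto simp: power_edges_def)
qed simp

text \<open>Take as placement the index in the list of cycle vertices. Going
  \<open>d \<le> k\<close> indices forward is a walk of length \<open>d\<close> on the cycle, so the
  end points have distance at most \<open>k\<close>.\<close>

lemma contains_ham_power_imp_power_edges:
  assumes "contains_ham_power k n B" "n > k"
  shows "\<exists>\<pi>\<in>placements n. power_edges n k \<pi> \<subseteq> B"
proof -
  from assms(1) obtain C vs where B: "graph_power k {1..n} C \<subseteq> B"
    and vs: "distinct vs" "set vs = {1..n}"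
    and C: "C = {{vs ! i, vs ! (Suc i mod length vs)} |i. i < length vs}"
    unfolding contains_ham_power_def hamilton_cycle_def by blast
  have len: "length vs = n" using vs distinct_card by fastforce
  define idx where "idx = the_inv_into {..<n} ((!) vs)"
  have bij: "bij_betw ((!) vs) {..<n} {1..n}"
    using vs len bij_betw_nth by (metis lessThan_atLeast0)
  have idx: "idx u < n" "vs ! idx u = u" if "u \<in> {1..n}" for u
    using bij that unfolding idx_def
    by (metis bij_betw_apply bij_betw_the_inv_into lessThan_iff,
        metis bij_betw_def f_the_inv_into_f)
  have bij_idx: "bij_betw idx {1..n} {..<n}"
    unfolding idx_def using bij by (rule bij_betw_the_inv_into)
  have bij_int: "bij_betw int {..<n} {0..<int n}"
    by (rule bij_betwI[where g = nat]) auto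
  define \<pi> where "\<pi> = int \<circ> idx"
  have "\<pi> \<in> placements n"
    using bij_betw_trans[OF bij_idx bij_int] by (simp add: placements_def \<pi>_def)
  moreover have "power_edges n k \<pi> \<subseteq> graph_power k {1..n} C"
  proof
    fix e assume "e \<in> power_edges n k \<pi>"
    then obtain u v where uv: "u \<in> {1..n}" "v \<in> {1..n}" "e = {u, v}"
      "(\<pi> v - \<pi> u) mod int n \<in> {1..int k}"
      by (rule power_edgesE)
    define d where "d = nat ((\<pi> v - \<pi> u) mod int n)"
    have d: "d \<le> k" "int d = (\<pi> v - \<pi> u) mod int n" using uv by (auto simp: d_def)
    have ne: "u \<noteq> v" using uv(4) by auto
    have walk: "(u, vs ! ((idx u + l) mod n)) \<in> {(x, y). {x, y} \<in> C} ^^ l" for l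
    proof (induction l)
      case 0
      then show ?case using idx[OF uv(1)] by simp
    next
      case (Suc l)
      have "{vs ! ((idx u + l) mod n), vs ! ((idx u + Suc l) mod n)} \<in> C"
        using assms(2) unfolding C len
        by (intro CollectI exI[of _ "(idx u + l) mod n"]) (simp add: mod_Suc_eq)
      then show ?case using Suc by auto
    qed
    have "int ((idx u + d) mod n) = (\<pi> u + (\<pi> v - \<pi> u) mod int n) mod int n"
      by (simp only: zmod_int of_nat_add d(2)) (simp add: \<pi>_def)
    also have "\<dots> = int (idx v mod n)" by (simp add: mod_add_right_eq \<pi>_def zmod_int)
    finally have "(idx u + d) mod n = idx v" using idx[OF uv(2)] by simp
    then have "(u, v) \<in> {(x, y). {x, y} \<in> C} ^^ d"
      using walk[of d] idx[OF uv(2)] by simp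
    then have "graph_dist C u v \<le> enat d"
      unfolding graph_dist_def by (intro INF_lower) auto
    then have "graph_dist C u v \<le> enat k" using d by (meson enat_ord_simps(1) order_trans)
    then show "e \<in> graph_power k {1..n} C" using uv ne unfolding graph_power_def by blast
  qed
  ultimately show ?thesis using B by blast
qed

section \<open>Numbering the purchased edges\<close>

text \<open>Its value just before a purchase serves as the index of that purchased edge in a
  code.\<close>

definition num_bought :: "(nat set list \<Rightarrow> bool) \<Rightarrow> nat set list \<Rightarrow> nat" where
  "num_bought D h = (\<Sum>i<length h. of_bool (D (take (Suc i) h)))"

lemma num_bought_take:
  "j \<le> length h \<Longrightarrow> num_bought D (take j h) = (\<Sum>i<j. of_bool (D (take (Suc i) h)))"
  unfolding num_bought_def by (rule sum.cong) (auto simp: min_def)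

lemma num_bought_snoc: "num_bought D (h @ [e]) = num_bought D h + of_bool (D (h @ [e]))"
  by (auto simp: num_bought_def intro!: sum.cong)

lemma num_bought_take_less:
  assumes "j < length h" "D (take (Suc j) h)"
  shows "num_bought D (take j h) < num_bought D h"
proof -
  have "num_bought D (take (Suc j) h) \<le> num_bought D (take (length h) h)"
    using assms(1) unfolding num_bought_take[OF Suc_leI[OF assms(1)]] num_bought_take[OF le_refl]
    by (intro sum_mono2) auto
  then show ?thesis using assms num_bought_take[of j h] num_bought_take[of "Suc j" h] by simp
qed

lemma purchased_eq_image: "purchased D es t = (!) es ` {i. i < t \<and> D (take (Suc i) es)}"
  by (simp only: purchased_def image_Collect)

lemma purchased_take:
  assumes "t \<le> length es"
  shows "purchased D (take t es) t = purchased D es t"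
  unfolding purchased_eq_image
proof (rule image_cong)
  show "{i. i < t \<and> D (take (Suc i) (take t es))} = {i. i < t \<and> D (take (Suc i) es)}"
    by (intro Collect_cong conj_cong refl) (simp add: min_absorb1)
qed simp

lemma purchased_snoc:
  "purchased D (h @ [e]) (Suc (length h))
     = purchased D h (length h) \<union> (if D (h @ [e]) then {e} else {})"
proof -
  have "{i. i < Suc (length h) \<and> D (take (Suc i) (h @ [e]))}
      = {i. i < length h \<and> D (take (Suc i) h)} \<union> (if D (h @ [e]) then {length h} else {})"
    by (auto simp: less_Suc_eq)
  moreover have "(!) (h @ [e]) ` {i. i < length h \<and> D (take (Suc i) h)}
      = (!) h ` {i. i < length h \<and> D (take (Suc i) h)}"
    by (rule image_cong) (simp_all add: nth_append)
  ultimately show ?thesis by (simp add: purchased_eq_image image_Un)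
qed

lemma card_purchased:
  assumes "distinct h"
  shows "card (purchased D h (length h)) = num_bought D h"
proof -
  have "inj_on ((!) h) {i. i < length h \<and> D (take (Suc i) h)}"
    using assms by (intro inj_on_nth) auto
  then have "card (purchased D h (length h)) = card {i. i < length h \<and> D (take (Suc i) h)}"
    by (simp add: card_image purchased_eq_image)
  also have "{i. i < length h \<and> D (take (Suc i) h)} = {..<length h} \<inter> {i. D (take (Suc i) h)}"
    by auto
  finally show ?thesis by (simp add: num_bought_def)
qed

section \<open>Codes, compatible placements and forced edges\<close>

text \<open>Orienting an edge by vertex labels makes the difference well defined without knowing the
  placement.\<close>

definition edge_diff :: "nat \<Rightarrow> (nat \<Rightarrow> int) \<Rightarrow> nat set \<Rightarrow> int" where
  "edge_diff n \<pi> e = (\<pi> (Max e) - \<pi> (Min e)) mod int n"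

text \<open>The residues of \<open>1, ..., k\<close> and \<open>-1, ..., -k\<close>: the orientation
  by labels may run against the cycle. This is the source of the factor \<open>2 * k\<close> in the
  number of codes.\<close>

definition edge_diffs :: "nat \<Rightarrow> nat \<Rightarrow> int set" where
  "edge_diffs n k = {1..int k} \<union> {int n - int k..<int n}"

lemma finite_edge_diffs [simp]: "finite (edge_diffs n k)"
  by (simp add: edge_diffs_def)

lemma card_edge_diffs_le: "card (edge_diffs n k) \<le> 2 * k"
  using card_Un_le[of "{1..int k}" "{int n - int k..<int n}"] by (simp add: edge_diffs_def)

lemma edge_diff_in_edge_diffs:
  assumes "e \<in> power_edges n k \<pi>" "n > k"
  shows "edge_diff n \<pi> e \<in> edge_diffs n k"
proof -
  obtain u v where uv: "e = {u, v}" "(\<pi> v - \<pi> u) mod int n \<in> {1..int k}"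
    using assms(1) by (rule power_edgesE)
  then have "u \<noteq> v" by auto
  then consider "u < v" | "v < u" by linarith
  then show ?thesis
  proof cases
    case 1
    then show ?thesis using uv by (simp add: edge_diff_def edge_diffs_def)
  next
    case 2
    have "(\<pi> u - \<pi> v) mod int n = int n - (\<pi> v - \<pi> u) mod int n"
      using uv(2) zmod_zminus1_eq_if[of "\<pi> v - \<pi> u" "int n"] by auto
    then show ?thesis using uv 2 assms(2) by (auto simp add: edge_diff_def edge_diffs_def)
  qed
qed

lemma edge_diff_eqD:
  assumes "edge_diff n \<pi>' {u, v} = edge_diff n \<pi> {u, v}"
  shows "(\<pi>' v - \<pi>' u) mod int n = (\<pi> v - \<pi> u) mod int n"
proof (cases "u \<le> v")
  case True
  then show ?thesis using assms by (simp add: edge_diff_def max_def min_def)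
next
  case False
  then have "(\<pi>' u - \<pi>' v) mod int n = (\<pi> u - \<pi> v) mod int n"
    using assms by (simp add: edge_diff_def max_def min_def)
  then show ?thesis using mod_minus_cong by fastforce
qed

text \<open>
  A code \<open>S\<close> prescribes, for some indices \<open>j\<close>, the difference of the positions (on the cycle) of
  the end points of the \<open>j\<close>-th purchased edge.
\<close>

definition compatible ::
  "nat \<Rightarrow> (nat set list \<Rightarrow> bool) \<Rightarrow> (nat \<times> int) set \<Rightarrow> nat set list \<Rightarrow> (nat \<Rightarrow> int) set" where
  "compatible n D S h = {\<pi> \<in> placements n. \<forall>i<length h. D (take (Suc i) h) \<longrightarrow>
     (\<forall>d. (num_bought D (take i h), d) \<in> S \<longrightarrow> edge_diff n \<pi> (h ! i) = d)}"

text \<open>The edges not yet seen that lie in every copy still consistent with the code. The empty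
  case is separate because an intersection over no placements would be the whole type.\<close>

definition forced ::
  "nat \<Rightarrow> nat \<Rightarrow> (nat set list \<Rightarrow> bool) \<Rightarrow> (nat \<times> int) set \<Rightarrow> nat set list \<Rightarrow> nat set set" where
  "forced n k D S h = (if compatible n D S h = {} then {}
     else (\<Inter>\<pi>\<in>compatible n D S h. power_edges n k \<pi>) - set h)"

lemma compatible_snoc:
  "compatible n D S (h @ [e]) = {\<pi> \<in> compatible n D S h. D (h @ [e]) \<longrightarrow>
     (\<forall>d. (num_bought D h, d) \<in> S \<longrightarrow> edge_diff n \<pi> e = d)}"
  by (auto simp: compatible_def less_Suc_eq nth_append all_conj_distrib)

text \<open>By \<open>num_bought_take_less\<close>, no purchase within \<open>h\<close> has the
  index \<open>num_bought D h\<close>. Hence recording the next purchase changes neither earlier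
  target sets nor earlier hits.\<close>

lemma compatible_insert:
  assumes "i \<le> length h"
  shows "compatible n D (insert (num_bought D h, d) S) (take i h) = compatible n D S (take i h)"
proof -
  have "num_bought D (take j (take i h)) \<noteq> num_bought D h"
    if "j < length (take i h)" "D (take (Suc j) (take i h))" for j
    using num_bought_take_less[of j h D] that assms by (auto simp: min_def split: if_splits)
  then show ?thesis unfolding compatible_def by blast
qed

lemma finite_forced: "finite (forced n k D S h)"
proof (cases "compatible n D S h = {}")
  case False
  then obtain \<pi> where "\<pi> \<in> compatible n D S h" by blast
  then have "forced n k D S h \<subseteq> power_edges n k \<pi>" by (auto simp: forced_def)
  then show ?thesis using finite_power_edges finite_subset by blast
qed (simp add: forced_def)

text \<open>As the history grows, fewer placements stay compatible, so the set of edges common to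
  all of them only grows. Every hit thus remains in it, and no edge is hit twice because
  \<open>forced\<close> excludes edges already seen.\<close>

lemma hits_forced_le:
  "compatible n D S h \<noteq> {} \<Longrightarrow> hits (forced n k D S) h
     \<le> card ((\<Inter>\<pi>\<in>compatible n D S h. power_edges n k \<pi>) \<inter> set h)"
proof (induction h rule: rev_induct)
  case (snoc e h)
  let ?I = "\<lambda>h. \<Inter>\<pi>\<in>compatible n D S h. power_edges n k \<pi>"
  have sub: "compatible n D S (h @ [e]) \<subseteq> compatible n D S h"
    by (auto simp: compatible_snoc)
  then have ne: "compatible n D S h \<noteq> {}" using snoc.prems by blast
  have I: "?I h \<subseteq> ?I (h @ [e])" using sub by blast
  have "hits (forced n k D S) (h @ [e]) \<le> card (?I h \<inter> set h) + of_bool (e \<in> forced n k D S h)"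
    using snoc.IH[OF ne] by (simp add: hits_snoc)
  also have "\<dots> = card (?I h \<inter> set h \<union> (if e \<in> forced n k D S h then {e} else {}))"
    using ne by (auto simp: forced_def)
  also have "\<dots> \<le> card (?I (h @ [e]) \<inter> set (h @ [e]))"
    using I ne by (intro card_mono) (auto simp: forced_def)
  finally show ?case .
qed simp

text \<open>Provides the hypothesis of \<open>adaptive_hits\<close> with \<open>R = k * n\<close>:
  seen and unseen common edges together fit into a single copy.\<close>

lemma hits_forced_add_card_le:
  assumes "n \<ge> 2 * k + 1" "forced n k D S h \<noteq> {}"
  shows "hits (forced n k D S) h + card (forced n k D S h) \<le> k * n"
proof -
  let ?I = "\<Inter>\<pi>\<in>compatible n D S h. power_edges n k \<pi>"
  have ne: "compatible n D S h \<noteq> {}" using assms(2) by (auto simp: forced_def)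
  then obtain \<pi> where pi: "\<pi> \<in> compatible n D S h" by blast
  then have sub: "?I \<subseteq> power_edges n k \<pi>" by blast
  then have fin: "finite ?I" using finite_power_edges by (rule finite_subset)
  have "hits (forced n k D S) h + card (forced n k D S h) \<le> card (?I \<inter> set h) + card (?I - set h)"
    using hits_forced_le[OF ne] ne by (simp add: forced_def)
  also have "\<dots> = card ?I" by (rule card_Int_Diff[OF fin, symmetric])
  also have "\<dots> \<le> card (power_edges n k \<pi>)" using sub finite_power_edges by (rule card_mono[rotated])
  also have "\<dots> = k * n" using pi assms(1) by (intro card_power_edges) (auto simp: compatible_def)
  finally show ?thesis .
qed

text \<open>
  The fibres of \<open>f\<close> are the components of the graph formed by the edges recorded in \<open>S\<close>.  Every
  purchased edge of the target copy either is forced or joins two of them and gets recorded.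
\<close>

definition codes ::
  "nat \<Rightarrow> nat \<Rightarrow> (nat set list \<Rightarrow> bool) \<Rightarrow> (nat \<Rightarrow> int) \<Rightarrow> nat set list \<Rightarrow> (nat \<times> int) set \<Rightarrow>
   (nat \<Rightarrow> nat) \<Rightarrow> bool" where
  "codes n k D \<pi> h S f \<longleftrightarrow>
    S \<subseteq> {..<num_bought D h} \<times> edge_diffs n k \<and> \<pi> \<in> compatible n D S h \<and>
    card (power_edges n k \<pi> \<inter> purchased D h (length h)) \<le> card S + hits (forced n k D S) h \<and>
    card (f ` {1..n}) + card S \<le> n \<and>
    (\<forall>x\<in>{1..n}. \<forall>y\<in>{1..n}. f x = f y \<longrightarrow>
       (\<forall>\<pi>'\<in>compatible n D S h. (\<pi>' x - \<pi>' y) mod int n = (\<pi> x - \<pi> y) mod int n))"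

lemma codesI:
  assumes "S \<subseteq> {..<num_bought D h} \<times> edge_diffs n k" "\<pi> \<in> compatible n D S h"
    "card (power_edges n k \<pi> \<inter> purchased D h (length h)) \<le> card S + hits (forced n k D S) h"
    "card (f ` {1..n}) + card S \<le> n"
    "\<And>x y \<pi>'. x \<in> {1..n} \<Longrightarrow> y \<in> {1..n} \<Longrightarrow> f x = f y \<Longrightarrow> \<pi>' \<in> compatible n D S h \<Longrightarrow>
       (\<pi>' x - \<pi>' y) mod int n = (\<pi> x - \<pi> y) mod int n"
  shows "codes n k D \<pi> h S f"
  unfolding codes_def by (intro conjI ballI impI; rule assms; assumption)

lemmas codesD =
  codes_def[THEN iffD1, THEN conjunct1]
  codes_def[THEN iffD1, THEN conjunct2, THEN conjunct1]
  codes_def[THEN iffD1, THEN conjunct2, THEN conjunct2, THEN conjunct1]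
  codes_def[THEN iffD1, THEN conjunct2, THEN conjunct2, THEN conjunct2, THEN conjunct1]
  codes_def[THEN iffD1, THEN conjunct2, THEN conjunct2, THEN conjunct2, THEN conjunct2, rule_format]

text \<open>The code is built along the history as in Kruskal's algorithm: each recorded edge merges
  two fibres of \<open>f\<close>, so the number of fibres plus \<open>card S\<close> never exceeds
  \<open>n\<close>.\<close>

lemma exists_codes:
  assumes pi: "\<pi> \<in> placements n" and n: "n > k" and h: "distinct h"
  shows "\<exists>S f. codes n k D \<pi> h S f"
  using h
proof (induction h rule: rev_induct)
  case Nil
  \<comment> \<open>Nothing is recorded yet, so every vertex is a component of its own.\<close>
  have "codes n k D \<pi> [] {} (\<lambda>x. x)"
    using pi by (intro codesI) (simp_all add: compatible_def purchased_def)
  then show ?case by blast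
next
  case (snoc e h)
  let ?H = "power_edges n k \<pi>"
  let ?B = "purchased D h (length h)" and ?B' = "purchased D (h @ [e]) (length (h @ [e]))"
  from snoc obtain S f where code: "codes n k D \<pi> h S f" by force
  note S = codesD(1)[OF code] and piS = codesD(2)[OF code] and hS = codesD(3)[OF code]
    and fS = codesD(4)[OF code] and same = codesD(5)[OF code]
  have e: "e \<notin> set h" using snoc.prems by simp
  have sub: "compatible n D S' (h @ [e]) \<subseteq> compatible n D S' h" for S'
    by (auto simp: compatible_snoc)
  \<comment> \<open>All indices in \<open>S\<close> are below \<open>num_bought D h\<close>, so
    \<open>S\<close> puts no condition on \<open>e\<close>.\<close>
  have piS': "\<pi> \<in> compatible n D S (h @ [e])"
    using piS S by (auto simp: compatible_snoc)
  have S': "S \<subseteq> {..<num_bought D (h @ [e])} \<times> edge_diffs n k"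
    using S by (auto simp: num_bought_snoc)
  have card1: "card (?H \<inter> ?B') \<le> card (?H \<inter> ?B) + 1"
  proof -
    have "?H \<inter> ?B' \<subseteq> insert e (?H \<inter> ?B)" by (auto simp: purchased_snoc split: if_splits)
    then have "card (?H \<inter> ?B') \<le> card (insert e (?H \<inter> ?B))"
      by (intro card_mono) (auto simp: finite_power_edges)
    also have "\<dots> \<le> card (?H \<inter> ?B) + 1" by (simp add: card_insert_if finite_power_edges)
    finally show ?thesis .
  qed
  show ?case
  proof (cases "D (h @ [e]) \<and> e \<in> ?H")
    case False
    then have "?H \<inter> ?B' = ?H \<inter> ?B" by (auto simp: purchased_snoc)
    then have "card (?H \<inter> ?B') \<le> card S + hits (forced n k D S) (h @ [e])"
      using hS by (simp add: hits_snoc)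
    with S' piS' have "codes n k D \<pi> (h @ [e]) S f"
      by (rule codesI) (use fS same sub in blast)+
    then show ?thesis by blast
  next
    case True
    then obtain u v where uv: "u \<in> {1..n}" "v \<in> {1..n}" "e = {u, v}"
      "(\<pi> v - \<pi> u) mod int n \<in> {1..int k}"
      by (metis power_edgesE)
    show ?thesis
    proof (cases "f u = f v")
      case True
      \<comment> \<open>Within one component all compatible placements agree on differences, so
        \<open>e\<close> lies in each of their copies and its arrival is a hit.\<close>
      have "e \<in> power_edges n k \<pi>'" if "\<pi>' \<in> compatible n D S h" for \<pi>'
        unfolding uv(3) using same[OF uv(2,1) True[symmetric] that] uv by (intro power_edgesI) auto
      then have "e \<in> forced n k D S h" using piS e by (auto simp: forced_def)
      then have "card (?H \<inter> ?B') \<le> card S + hits (forced n k D S) (h @ [e])"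
        using hS card1 by (simp add: hits_snoc)
      with S' piS' have "codes n k D \<pi> (h @ [e]) S f"
        by (rule codesI) (use fS same sub in blast)+
      then show ?thesis by blast
    next
      case False
      define d where "d = edge_diff n \<pi> e"
      \<comment> \<open>Record \<open>e\<close> under its index, and let \<open>f2\<close> merge the
        component of \<open>v\<close> into that of \<open>u\<close>.\<close>
      define S2 where "S2 = insert (num_bought D h, d) S"
      define f2 where "f2 = (\<lambda>x. if f x = f v then f u else f x)"
      have finS: "finite S" using S by (rule finite_subset) simp
      have "d \<in> edge_diffs n k"
        using edge_diff_in_edge_diffs n \<open>D (h @ [e]) \<and> e \<in> ?H\<close> unfolding d_def by blast
      then have 1: "S2 \<subseteq> {..<num_bought D (h @ [e])} \<times> edge_diffs n k"
        using S' \<open>D (h @ [e]) \<and> e \<in> ?H\<close> by (auto simp: S2_def num_bought_snoc)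
      have compat: "compatible n D S2 (take i h) = compatible n D S (take i h)"
        if "i \<le> length h" for i
        unfolding S2_def by (rule compatible_insert[OF that])
      have compat_h: "compatible n D S2 h = compatible n D S h"
        using compat[of "length h"] by simp
      have 2: "\<pi> \<in> compatible n D S2 (h @ [e])"
        unfolding compatible_snoc compat_h using piS S by (auto simp: S2_def d_def)
      have cardS2: "card S2 = Suc (card S)"
        unfolding S2_def using finS S by (subst card_insert_disjoint) auto
      have "hits (forced n k D S2) h = hits (forced n k D S) h"
        using compat by (intro hits_cong) (simp add: forced_def)
      then have 3: "card (?H \<inter> ?B') \<le> card S2 + hits (forced n k D S2) (h @ [e])"
        using hS card1 cardS2 by (simp add: hits_snoc)
      have "f2 ` {1..n} \<subseteq> f ` {1..n} - {f v}" using uv False by (auto simp: f2_def)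
      then have "card (f2 ` {1..n}) \<le> card (f ` {1..n} - {f v})" by (intro card_mono) auto
      also have "\<dots> = card (f ` {1..n}) - 1" using uv by simp
      finally have "card (f2 ` {1..n}) \<le> card (f ` {1..n}) - 1" .
      moreover have "card (f ` {1..n}) > 0" using uv by (auto simp: card_gt_0_iff)
      ultimately have 4: "card (f2 ` {1..n}) + card S2 \<le> n" using fS cardS2 by simp
      have 5: "(\<pi>' x - \<pi>' y) mod int n = (\<pi> x - \<pi> y) mod int n"
        if xy: "x \<in> {1..n}" "y \<in> {1..n}" "f2 x = f2 y" and pi': "\<pi>' \<in> compatible n D S2 (h @ [e])"
        for x y \<pi>'
      proof -
        have old: "(\<pi>' a - \<pi>' b) mod int n = (\<pi> a - \<pi> b) mod int n"
          if "a \<in> {1..n}" "b \<in> {1..n}" "f a = f b" for a b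
          using same that pi' sub compat_h by blast
        have "edge_diff n \<pi>' e = d"
          using pi' \<open>D (h @ [e]) \<and> e \<in> ?H\<close> by (auto simp: compatible_snoc S2_def)
        then have vu: "(\<pi>' v - \<pi>' u) mod int n = (\<pi> v - \<pi> u) mod int n"
          unfolding d_def uv(3) by (rule edge_diff_eqD)
        \<comment> \<open>Add the differences along \<open>a\<close>, \<open>v\<close>,
          \<open>u\<close>, \<open>c\<close>: the outer two are known within the old components, the
          middle one is recorded with \<open>e\<close>.\<close>
        have cross: "(\<pi>' a - \<pi>' c) mod int n = (\<pi> a - \<pi> c) mod int n"
          if "a \<in> {1..n}" "c \<in> {1..n}" "f a = f v" "f c = f u" for a c
          using mod_add_cong[OF mod_add_cong[OF old[OF that(1) uv(2) that(3)] vu]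
              old[OF uv(1) that(2) that(4)[symmetric]]] by simp
        consider "f x = f y" | "f x = f v" "f y = f u" | "f x = f u" "f y = f v"
          using xy(3) by (auto simp: f2_def split: if_splits)
        then show ?thesis
        proof cases
          case 1
          then show ?thesis using old xy by blast
        next
          case 2
          then show ?thesis using cross xy by blast
        next
          case 3
          then show ?thesis using mod_minus_cong[OF cross[of y x]] xy by simp
        qed
      qed
      from 1 2 3 4 5 have "codes n k D \<pi> (h @ [e]) S2 f2" by (rule codesI)
      then show ?thesis by blast
    qed
  qed
qed

section \<open>Union bound over the codes for a fixed decision rule\<close>

lemma card_complete_edges: "card (complete_edges n) = n choose 2"
  unfolding complete_edges_def using n_subsets[of "{1..n}" 2] by simp

lemma finite_complete_edges: "finite (complete_edges n)"
  by (rule finite_subset[of _ "Pow {1..n}"]) (auto simp: complete_edges_def)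

text \<open>An exponential moment argument: every successful order has a code with at least
  \<open>(k - 1) * n\<close> hits, so it contributes at least \<open>z ^ ((k - 1) * n)\<close> to
  the sum of \<open>z ^ hits\<close> over all codes and orders. Exchanging the sums,
  \<open>adaptive_hits\<close> bounds the part of each code.\<close>

lemma card_success_le:
  fixes D :: "nat set list \<Rightarrow> bool"
  assumes k: "k \<ge> 1" and n: "n \<ge> 2 * k + 1" and t: "t \<le> n choose 2" "t > 0"
    and b: "\<And>es. es \<in> edge_orders n \<Longrightarrow> card (purchased D es t) \<le> b"
  shows "real (card {es \<in> edge_orders n. contains_ham_power k n (purchased D es t)})
     \<le> fact (n choose 2) *
        ((exp 1 * real (2 * k * b) / n) ^ n * 2 ^ (k * n) * (t / real (n choose 2)) ^ ((k - 1) * n))"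
proof (cases "{es \<in> edge_orders n. contains_ham_power k n (purchased D es t)} = {}")
  case True
  have "0 \<le> fact (n choose 2) * ((exp 1 * real (2 * k * b) / n) ^ n * 2 ^ (k * n) *
      (t / real (n choose 2)) ^ ((k - 1) * n))"
    by (intro mult_nonneg_nonneg zero_le_power divide_nonneg_nonneg) auto
  then show ?thesis unfolding True card.empty of_nat_0 .
next
  case False
  define M where "M = n choose 2"
  define G where "G = {es \<in> edge_orders n. contains_ham_power k n (purchased D es t)}"
  \<comment> \<open>With this choice \<open>1 + (z - 1) * (t / M)\<close> is
    \<open>2 - t / M\<close>, hence at most \<open>2\<close>, while \<open>z ^ ((k - 1) * n)\<close>
    yields the desired power of \<open>t / M\<close>.\<close>
  define z where "z = real M / real t"
  define A where "A = {..<b} \<times> edge_diffs n k"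
  define Sf where "Sf = {S. S \<subseteq> A \<and> card S \<le> n}"
  have M: "M > 0" "t \<le> M" using t unfolding M_def by linarith+
  have z: "z \<ge> 1" using t M by (simp add: z_def)
  have es: "distinct es" "length es = M" if "es \<in> edge_orders n" for es
    using that distinct_card[of es] unfolding edge_orders_def M_def
    by (auto simp: permutations_of_set_def card_complete_edges)
  have G: "\<exists>\<pi>\<in>placements n. power_edges n k \<pi> \<subseteq> purchased D es t" if "es \<in> G" for es
    using that n contains_ham_power_imp_power_edges[of k n] by (auto simp: G_def)
  \<comment> \<open>One successful order forces the budget to pay for a whole copy. This gives
    \<open>n \<le> 2 * k * b\<close>, as the count of codes requires, and explains the separate case
    without successful orders.\<close>
  have "k * n \<le> b"
  proof -
    obtain es where "es \<in> G" using False by (auto simp: G_def)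
    then obtain \<pi> where pi: "\<pi> \<in> placements n" "power_edges n k \<pi> \<subseteq> purchased D es t"
      using G by blast
    have "k * n = card (power_edges n k \<pi>)" using card_power_edges pi n by simp
    also have "\<dots> \<le> card (purchased D es t)"
      using pi by (intro card_mono) (auto simp: purchased_def)
    also have "\<dots> \<le> b" using b \<open>es \<in> G\<close> by (simp add: G_def)
    finally show ?thesis .
  qed
  then have nb: "n \<le> 2 * k * b"
    using k mult_le_mono[of 1 k n n] mult_le_mono[of 1 "2 * k" b b] by linarith
  have finA: "finite A" by (simp add: A_def)
  then have finSf: "finite Sf" by (simp add: Sf_def)
  have cardA: "card A \<le> 2 * k * b"
    using card_edge_diffs_le[of n k] by (simp add: A_def card_cartesian_product)
  have cardSf: "real (card Sf) \<le> (exp 1 * real (2 * k * b) / n) ^ n"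
    unfolding Sf_def using nb cardA n finA by (intro card_bounded_subsets_exp_le) (simp_all del: of_nat_mult)
  have code: "z ^ ((k - 1) * n) \<le> (\<Sum>S\<in>Sf. z ^ hits (forced n k D S) (take t es))"
    if esG: "es \<in> G" for es
  proof -
    have eo: "es \<in> edge_orders n" using esG by (simp add: G_def)
    define h where "h = take t es"
    have h: "distinct h" "length h = t" using es[OF eo] M by (auto simp: h_def)
    obtain \<pi> where pi: "\<pi> \<in> placements n" "power_edges n k \<pi> \<subseteq> purchased D es t"
      using G[OF esG] by blast
    have ph: "purchased D h (length h) = purchased D es t"
      unfolding h(2) unfolding h_def using purchased_take M es[OF eo] by simp
    obtain S f where "codes n k D \<pi> h S f"
      using exists_codes[OF pi(1) _ h(1), of k D] n by auto
    note S = codesD(1,3,4)[OF this]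
    have "num_bought D h \<le> b" using card_purchased[OF h(1), of D] ph b[OF eo] by simp
    then have "S \<in> Sf" using S by (auto simp: Sf_def A_def)
    \<comment> \<open>All \<open>k * n\<close> edges of the copy were bought and at most
      \<open>n\<close> of them are recorded; the others are hits.\<close>
    have "k * n \<le> card S + hits (forced n k D S) h"
      using S(2) pi(2) card_power_edges[OF pi(1) n] by (simp add: ph Int_absorb2)
    then have "(k - 1) * n \<le> hits (forced n k D S) h"
      using S(3) by (simp add: diff_mult_distrib)
    then have "z ^ ((k - 1) * n) \<le> z ^ hits (forced n k D S) h" using z by (rule power_increasing)
    also have "\<dots> \<le> (\<Sum>S\<in>Sf. z ^ hits (forced n k D S) h)"
      using \<open>S \<in> Sf\<close> finSf z by (intro member_le_sum) auto
    finally show ?thesis by (simp add: h_def)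
  qed
  have adaptive: "(\<Sum>es\<in>edge_orders n. z ^ hits (forced n k D S) (take t es))
      \<le> fact M * 2 ^ (k * n)" for S
  proof -
    have "(\<Sum>es\<in>edge_orders n. z ^ hits (forced n k D S) (take t es))
        \<le> fact M * (1 + (z - 1) * (real t / real M)) ^ (k * n)"
      using adaptive_hits[OF finite_complete_edges, of t n z "forced n k D S" "k * n"] M(2) z
        finite_forced hits_forced_add_card_le[OF n]
      by (simp add: edge_orders_def card_complete_edges M_def)
    also have "1 + (z - 1) * (real t / real M) = 2 - real t / real M"
      using t M by (simp add: z_def field_simps)
    also have "fact M * (2 - real t / real M) ^ (k * n) \<le> fact M * 2 ^ (k * n)"
      using M by (intro mult_left_mono power_mono) (auto simp: divide_le_eq)
    finally show ?thesis .
  qed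
  have "real (card G) * z ^ ((k - 1) * n) = (\<Sum>es\<in>G. z ^ ((k - 1) * n))" by simp
  also have "\<dots> \<le> (\<Sum>es\<in>G. \<Sum>S\<in>Sf. z ^ hits (forced n k D S) (take t es))"
    by (intro sum_mono code)
  also have "\<dots> \<le> (\<Sum>es\<in>edge_orders n. \<Sum>S\<in>Sf. z ^ hits (forced n k D S) (take t es))"
    using z finite_edge_orders by (intro sum_mono2) (auto simp: G_def intro!: sum_nonneg)
  also have "\<dots> = (\<Sum>S\<in>Sf. \<Sum>es\<in>edge_orders n. z ^ hits (forced n k D S) (take t es))"
    by (rule sum.swap)
  also have "\<dots> \<le> (\<Sum>S\<in>Sf. fact M * 2 ^ (k * n))"
    by (intro sum_mono adaptive)
  also have "\<dots> = real (card Sf) * (fact M * 2 ^ (k * n))" by simp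
  also have "\<dots> \<le> (exp 1 * real (2 * k * b) / n) ^ n * (fact M * 2 ^ (k * n))"
    using cardSf by (intro mult_right_mono) auto
  finally have "real (card G)
      \<le> (exp 1 * real (2 * k * b) / n) ^ n * (fact M * 2 ^ (k * n)) / z ^ ((k - 1) * n)"
    using z by (simp add: pos_le_divide_eq)
  then show ?thesis
    unfolding G_def[symmetric] M_def[symmetric]
    by (simp add: z_def power_divide mult_ac)
qed

section \<open>Random seeds and the final estimate\<close>

text \<open>Fubini: a bound on the proportion of orders that holds for each fixed seed survives
  integration over the seed.\<close>

lemma measure_process_le:
  assumes "prob_space \<Omega>" and A: "A \<in> sets (process_measure n \<Omega>)" and c: "c \<ge> 0"
    and le: "\<And>\<omega>. \<omega> \<in> space \<Omega> \<Longrightarrow>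
      real (card {es \<in> edge_orders n. (\<omega>, es) \<in> A}) \<le> real (card (edge_orders n)) * c"
  shows "measure (process_measure n \<Omega>) A \<le> c"
proof -
  interpret prob_space \<Omega> by fact
  let ?U = "uniform_count_measure (edge_orders n)"
  have ne: "edge_orders n \<noteq> {}"
    using finite_complete_edges by (simp add: edge_orders_def)
  interpret U: prob_space ?U
    using finite_edge_orders ne by (rule prob_space_uniform_count_measure)
  have sub: "A \<subseteq> space \<Omega> \<times> edge_orders n"
    using sets.sets_into_space[OF A]
    by (simp add: process_measure_def space_pair_measure space_uniform_count_measure)
  have "emeasure (process_measure n \<Omega>) A = (\<integral>\<^sup>+\<omega>. emeasure ?U (Pair \<omega> -` A) \<partial>\<Omega>)"
    using A unfolding process_measure_def by (rule U.emeasure_pair_measure_alt)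
  also have "\<dots> \<le> (\<integral>\<^sup>+\<omega>. ennreal c \<partial>\<Omega>)"
  proof (rule nn_integral_mono)
    fix \<omega> assume w: "\<omega> \<in> space \<Omega>"
    have eq: "Pair \<omega> -` A = {es \<in> edge_orders n. (\<omega>, es) \<in> A}" using sub by auto
    have "emeasure ?U (Pair \<omega> -` A)
        = ennreal (real (card {es \<in> edge_orders n. (\<omega>, es) \<in> A}) / card (edge_orders n))"
      unfolding eq using finite_edge_orders by (intro emeasure_uniform_count_measure) auto
    also have "\<dots> \<le> ennreal c"
      using le[OF w] ne finite_edge_orders
      by (intro ennreal_leI) (simp add: divide_le_eq card_gt_0_iff mult.commute)
    finally show "emeasure ?U (Pair \<omega> -` A) \<le> ennreal c" .
  qed
  also have "\<dots> = ennreal c" by (simp add: emeasure_space_1)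
  finally show ?thesis using c by (simp add: measure_def enn2real_leI)
qed

text \<open>The outer \<open>2\<close> comes from \<open>x \<ge> 1 / 2\<close> in
  \<open>budget_lower_bound\<close>, the bracket from the number of codes and the factor
  \<open>2 ^ (k * n)\<close>, and \<open>4 ^ (k - 1)\<close> from
  \<open>n choose 2 \<ge> n ^ 2 / 4\<close>.\<close>

definition bound_const :: "nat \<Rightarrow> real" where
  "bound_const k = 1 / (2 * (exp 1 * (2 * real k) * 2 ^ k) * 4 ^ (k - 1))"

lemma bound_const_pos: "k > 0 \<Longrightarrow> bound_const k > 0"
  by (simp add: bound_const_def)

text \<open>The success probability is at most \<open>x ^ n\<close>, where \<open>x\<close> is a
  constant times \<open>b / n * (t / M) ^ (k - 1)\<close>. So \<open>x\<close> cannot be below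
  \<open>1 / 2\<close>, and solving for \<open>b\<close> gives the claim.\<close>

lemma budget_lower_bound:
  assumes k: "k \<ge> 1" and n: "n \<ge> 2 * k + 1" and t: "t > 0"
    and strat: "tb_strategy n t b \<Omega> \<sigma>"
    and prob: "\<P>(x in process_measure n \<Omega>. contains_ham_power k n (purchased (\<sigma> (fst x)) (snd x) t)) > 1 / 2"
  shows "bound_const k * real n ^ (2 * k - 1) / real t ^ (k - 1) \<le> real b"
proof -
  define M where "M = n choose 2"
  define q where "q = exp 1 * (2 * real k) * (2::real) ^ k"
  define x where "x = q * (real b / n) * (t / real M) ^ (k - 1)"
  have q: "q > 0" using k by (simp add: q_def)
  have tM: "t \<le> M" using strat by (simp add: tb_strategy_def M_def)
  have x0: "x \<ge> 0" using q by (simp add: x_def)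
  let ?P = "\<lambda>x. contains_ham_power k n (purchased (\<sigma> (fst x)) (snd x) t)"
  let ?A = "{x \<in> space (process_measure n \<Omega>). ?P x}"
  have card_orders: "card (edge_orders n) = fact M"
    by (simp add: edge_orders_def card_permutations_of_set finite_complete_edges
        card_complete_edges M_def)
  have "measure (process_measure n \<Omega>) ?A \<le> x ^ n"
  proof (rule measure_process_le)
    show "prob_space \<Omega>" using strat by (simp add: tb_strategy_def)
    show "?A \<in> sets (process_measure n \<Omega>)" by (rule success_event_measurable[OF strat])
    show "0 \<le> x ^ n" using x0 by simp
    fix \<omega> assume w: "\<omega> \<in> space \<Omega>"
    have "{es \<in> edge_orders n. (\<omega>, es) \<in> ?A}
        = {es \<in> edge_orders n. contains_ham_power k n (purchased (\<sigma> \<omega>) es t)}"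
      using w by (auto simp: process_measure_def space_pair_measure space_uniform_count_measure)
    also have "real (card \<dots>) \<le> fact M * ((exp 1 * real (2 * k * b) / n) ^ n * 2 ^ (k * n) *
        (t / real M) ^ ((k - 1) * n))"
      unfolding M_def using strat w tM t
      by (intro card_success_le[OF k n]) (simp_all add: tb_strategy_def M_def)
    also have "\<dots> = fact M * x ^ n"
      by (simp add: x_def q_def power_mult power_mult_distrib power_divide)
    finally show "real (card {es \<in> edge_orders n. (\<omega>, es) \<in> ?A})
        \<le> real (card (edge_orders n)) * x ^ n"
      by (simp add: card_orders)
  qed
  then have xn: "x ^ n > 1 / 2" using prob by linarith
  have x: "x \<ge> 1 / 2"
  proof (rule ccontr)
    assume "\<not> x \<ge> 1 / 2"
    then have "x ^ n \<le> x ^ 1" using x0 n by (intro power_decreasing) auto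
    then show False using xn \<open>\<not> x \<ge> 1 / 2\<close> by simp
  qed
  have "2 * M = n * (n - 1)"
    unfolding M_def choose_two by (rule dvd_mult_div_cancel) (cases n; simp)
  then have M4: "n * (2 * (n - 1)) = 4 * M" by simp
  \<comment> \<open>Since \<open>n \<ge> 2\<close>, \<open>n\<close> is at most
    \<open>2 * (n - 1)\<close>; this yields \<open>M \<ge> n ^ 2 / 4\<close>.\<close>
  have "n * n \<le> n * (2 * (n - 1))" using n k by (intro mult_le_mono2) linarith
  also note M4
  finally have "real (n * n) \<le> real (4 * M)" by (rule of_nat_mono)
  then have M: "real n ^ 2 / 4 \<le> real M" by (simp add: power2_eq_square)
  have n0: "real n > 0" using n by simp
  have "t / real M \<le> t / (real n ^ 2 / 4)"
    using M n0 t tM by (intro divide_left_mono mult_pos_pos) auto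
  then have "(t / real M) ^ (k - 1) \<le> (t / (real n ^ 2 / 4)) ^ (k - 1)"
    by (intro power_mono) auto
  then have "x \<le> q * (real b / n) * (t / (real n ^ 2 / 4)) ^ (k - 1)"
    unfolding x_def using q by (intro mult_left_mono) auto
  also have "\<dots> = q * (real b / n) * (4 ^ (k - 1) * real t ^ (k - 1) / real n ^ (2 * (k - 1)))"
    by (simp add: power_divide power_mult_distrib power_mult)
  also have "\<dots> = real b * (q * 4 ^ (k - 1) * real t ^ (k - 1)) / real n ^ Suc (2 * (k - 1))"
    using n0 by (simp add: field_simps)
  also have "Suc (2 * (k - 1)) = 2 * k - 1" using k by simp
  finally have "1 / 2 \<le> real b * (q * 4 ^ (k - 1) * real t ^ (k - 1)) / real n ^ (2 * k - 1)"
    using x by linarith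
  then have "real n ^ (2 * k - 1) \<le> real b * (2 * q * 4 ^ (k - 1) * real t ^ (k - 1))"
    using n0 by (simp add: pos_le_divide_eq mult_ac)
  then have "real n ^ (2 * k - 1) / (2 * q * 4 ^ (k - 1) * real t ^ (k - 1)) \<le> real b"
    using q t by (subst pos_divide_le_eq) auto
  then show ?thesis by (simp add: bound_const_def q_def)
qed

theorem theorem1p6:
  fixes k :: nat and t b :: "nat \<Rightarrow> nat"
  assumes "k \<ge> 2"
    and "\<exists>(\<Omega> :: nat \<Rightarrow> 'r measure) \<sigma>. successful_strategy (contains_ham_power k) t b \<Omega> \<sigma>"
  shows "\<exists>\<epsilon> :: nat \<Rightarrow> real. \<epsilon> \<in> o(\<lambda>_. 1) \<and>
           (\<forall>\<^sub>F n in sequentially.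
              real (b n) \<ge> real n powr (2 * real k - 1 - \<epsilon> n) / real (t n) ^ (k - 1))"
proof -
  obtain \<Omega> :: "nat \<Rightarrow> 'r measure" and \<sigma> where
    strat: "\<forall>\<^sub>F n in sequentially. tb_strategy n (t n) (b n) (\<Omega> n) (\<sigma> n)" and
    lim: "(\<lambda>n. \<P>(x in process_measure n (\<Omega> n).
       contains_ham_power k n (purchased (\<sigma> n (fst x)) (snd x) (t n)))) \<longlonglongrightarrow> 1"
    using assms(2) unfolding successful_strategy_def by blast
  have success: "\<forall>\<^sub>F n in sequentially. \<P>(x in process_measure n (\<Omega> n).
       contains_ham_power k n (purchased (\<sigma> n (fst x)) (snd x) (t n))) > 1 / 2"
    using lim by (rule order_tendstoD) simp
  \<comment> \<open>Chosen so that \<open>n powr (- \<epsilon> n)\<close> equals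
    \<open>bound_const k\<close>; it tends to \<open>0\<close> because \<open>ln n\<close> tends to
    infinity.\<close>
  define \<epsilon> where "\<epsilon> = (\<lambda>n. - ln (bound_const k) / ln (real n))"
  have c: "bound_const k > 0" using assms(1) by (intro bound_const_pos) simp
  have "filterlim (\<lambda>n. ln (real n)) at_top sequentially"
    by (rule filterlim_compose[OF ln_at_top filterlim_real_sequentially])
  then have "\<epsilon> \<longlonglongrightarrow> 0"
    unfolding \<epsilon>_def by (intro tendsto_divide_0[OF tendsto_const] filterlim_at_top_imp_at_infinity)
  then have "\<epsilon> \<in> o(\<lambda>_. 1)" by (intro smalloI_tendsto) auto
  moreover have "\<forall>\<^sub>F n in sequentially.
      real n powr (2 * real k - 1 - \<epsilon> n) / real (t n) ^ (k - 1) \<le> real (b n)"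
    using strat success eventually_ge_at_top[of "2 * k + 1"]
  proof eventually_elim
    case (elim n)
    have "real n powr (2 * real k - 1 - \<epsilon> n)
        = real n powr real (2 * k - 1) * real n powr (ln (bound_const k) / ln (real n))"
      using assms(1) by (simp add: powr_add[symmetric] \<epsilon>_def of_nat_diff)
    also have "real n powr (ln (bound_const k) / ln (real n)) = bound_const k"
      using elim(3) assms(1) c by (simp add: powr_def)
    also have "real n powr real (2 * k - 1) = real n ^ (2 * k - 1)"
      using elim(3) by (intro powr_realpow) simp
    finally have eq: "real n powr (2 * real k - 1 - \<epsilon> n) = bound_const k * real n ^ (2 * k - 1)"
      by simp
    show ?case
    \<comment> \<open>For \<open>t n = 0\<close> the denominator is \<open>0\<close> as
      \<open>k \<ge> 2\<close>, so the quotient is \<open>0\<close> by convention.\<close>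
    proof (cases "t n = 0")
      case True
      then show ?thesis using assms(1) by (simp add: power_0_left)
    next
      case False
      then show ?thesis
        unfolding eq using elim assms(1)
        by (intro budget_lower_bound[of k n "t n" "b n" "\<Omega> n" "\<sigma> n"]) simp_all
    qed
  qed
  ultimately show ?thesis by blast
qed

end
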